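(* Let $A$ and $B$ be abelian groups. There is an isomorphism of elliptic groups $${}_0A\coprod {}_0B\cong {}_0(A\oplus B\oplus \mathbb{Z}/3\mathbb{Z}).$$ More precisely, the maps $i:{}_0A\to {}_0(A\oplus B\oplus\mathbb{Z}/3\mathbb{Z})$, $i(x)=(x,0,0)$, and $j:{}_0B\to {}_0(A\oplus B\oplus\mathbb{Z}/3\mathbb{Z})$, $j(y)=(0,y,[1])$, are morphisms of elliptic groups forming a coproduct diagram of elliptic groups: for any elliptic group $E$ and any morphisms of elliptic groups $f:{}_0A\to E$ and $g:{}_0B\to E$, there exists a unique morphism of elliptic groups $h:{}_0(A\oplus B\oplus\mathbb{Z}/3\mathbb{Z})\to E$ such that $f=h\circ i$ and $g=h\circ j$.
   Context: An elliptic group is a set $S$ (possibly empty) with a binary operation $\ast$ satisfying, for all $x,y,z,w\in S$: (EG1) $x\ast y=y\ast x$; (EG2) $x\ast(x\ast y)=y$; (EG3) $x\ast(y\ast(z\ast w))=w\ast(y\ast(z\ast x))$. A morphism of elliptic groups $f:S\to T$ is a map with $f(x\ast y)=f(x)\ast f(y)$ for all $x,y$; an isomorphism is a bijective morphism. For an (additive) abelian group $A$ and $a\in A$, ${}_aA$ denotes the elliptic group with underlying set $A$ and operation $x\ast_a y=a-x-y$. $\oplus$ is the direct sum of abelian groups, $\coprod$ is the coproduct in the category of elliptic groups, and $[n]$ denotes the class of the integer $n$ in $\mathbb{Z}/3\mathbb{Z}$. *)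

theory Defs
  imports "HOL-Algebra.Elementary_Groups"
begin

record 'a elliptic = "'a partial_object" +
  eop :: "'a \<Rightarrow> 'a \<Rightarrow> 'a" (infixl "\<star>\<index>" 70)

text \<open>The carrier is allowed to be empty.\<close>

locale elliptic_group =
  fixes E :: "('a, 'm) elliptic_scheme" (structure)
  assumes closed: "\<lbrakk>x \<in> carrier E; y \<in> carrier E\<rbrakk> \<Longrightarrow> x \<star> y \<in> carrier E"
    and EG1: "\<lbrakk>x \<in> carrier E; y \<in> carrier E\<rbrakk> \<Longrightarrow> x \<star> y = y \<star> x"
    and EG2: "\<lbrakk>x \<in> carrier E; y \<in> carrier E\<rbrakk> \<Longrightarrow> x \<star> (x \<star> y) = y"
    and EG3: "\<lbrakk>x \<in> carrier E; y \<in> carrier E; z \<in> carrier E; w \<in> carrier E\<rbrakk>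
      \<Longrightarrow> x \<star> (y \<star> (z \<star> w)) = w \<star> (y \<star> (z \<star> x))"

definition elliptic_hom ::
  "('a, 'm) elliptic_scheme \<Rightarrow> ('b, 'n) elliptic_scheme \<Rightarrow> ('a \<Rightarrow> 'b) set" where
  "elliptic_hom S T =
     {f \<in> carrier S \<rightarrow> carrier T.
        \<forall>x \<in> carrier S. \<forall>y \<in> carrier S. f (x \<star>\<^bsub>S\<^esub> y) = f x \<star>\<^bsub>T\<^esub> f y}"

definition elliptic_iso ::
  "('a, 'm) elliptic_scheme \<Rightarrow> ('b, 'n) elliptic_scheme \<Rightarrow> ('a \<Rightarrow> 'b) set" where
  "elliptic_iso S T = {f \<in> elliptic_hom S T. bij_betw f (carrier S) (carrier T)}"

text \<open>
  The operation \<open>a - x - y\<close>, in the multiplicative notation that HOL-Algebra uses for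
  abelian groups.
\<close>

definition elliptic_of :: "('a, 'm) monoid_scheme \<Rightarrow> 'a \<Rightarrow> 'a elliptic" where
  "elliptic_of G a =
     \<lparr>carrier = carrier G, eop = (\<lambda>x y. a \<otimes>\<^bsub>G\<^esub> inv\<^bsub>G\<^esub> x \<otimes>\<^bsub>G\<^esub> inv\<^bsub>G\<^esub> y)\<rparr>"

text \<open>
  \<open>C\<close> with injections \<open>i\<close>, \<open>j\<close> is a coproduct of \<open>S\<close> and \<open>T\<close>. HOL cannot quantify over
  types inside a formula, so the universal property is stated for all test objects
  with elements in one type \<open>'e\<close>, which is a parameter. The mediating morphism is
  a function on \<open>carrier C\<close>; the condition \<open>h \<in> extensional (carrier C)\<close>
  fixes its irrelevant values elsewhere, so that \<open>\<exists>!\<close> expresses uniqueness on the carrier.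
\<close>

definition elliptic_coproduct ::
  "'e itself \<Rightarrow> 'a elliptic \<Rightarrow> 'b elliptic \<Rightarrow> 'c elliptic \<Rightarrow> ('a \<Rightarrow> 'c) \<Rightarrow> ('b \<Rightarrow> 'c) \<Rightarrow> bool" where
  "elliptic_coproduct TYPE('e) S T C i j \<longleftrightarrow>
     elliptic_group C \<and> i \<in> elliptic_hom S C \<and> j \<in> elliptic_hom T C \<and>
     (\<forall>(E :: 'e elliptic) f g.
        elliptic_group E \<longrightarrow> f \<in> elliptic_hom S E \<longrightarrow> g \<in> elliptic_hom T E \<longrightarrow>
        (\<exists>!h. h \<in> elliptic_hom C E \<and> h \<in> extensional (carrier C) \<and>
              (\<forall>x \<in> carrier S. f x = h (i x)) \<and> (\<forall>y \<in> carrier T. g y = h (j y))))"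

end

theory Submission
  imports Defs
begin

text \<open>
  An elliptic group with a base point \<open>p\<close> is an abelian group with neutral element \<open>p\<close> under
  \<open>x + y = p * (x * y)\<close>, and its operation is \<open>x * y = p * p - x - y\<close>. Take \<open>p = f 0\<close>;
  then \<open>p * p = p\<close>, so the operation on \<open>E\<close> is \<open>- x - y\<close> and \<open>f\<close> is a group
  homomorphism. The element \<open>e = g 0\<close> satisfies \<open>e = - 2 e\<close>, hence \<open>3 e = 0\<close>, and
  \<open>g - e\<close> is a group homomorphism. The mediating map is therefore the group homomorphism
  \<open>h (x, y, n) = f x + g y + (n - 1) e\<close>, and it is the only one since
  \<open>(x, y, n) = i x + j y + (n - 1) j 0\<close>.
\<close>

section \<open>Abelian groups from elliptic groups with a base point\<close>

definition pointed_group :: "('a, 'm) elliptic_scheme \<Rightarrow> 'a \<Rightarrow> 'a monoid" where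
  "pointed_group E p =
     \<lparr>carrier = carrier E, mult = (\<lambda>x y. p \<star>\<^bsub>E\<^esub> (x \<star>\<^bsub>E\<^esub> y)), one = p\<rparr>"

lemma (in elliptic_group) EG2': "\<lbrakk>x \<in> carrier E; y \<in> carrier E\<rbrakk> \<Longrightarrow> x \<star> (y \<star> x) = y"
  using EG1 EG2 by simp

text \<open>Associativity is EG3 in disguise, EG2 makes \<open>p\<close> neutral, and the inverse of
  \<open>x\<close> is \<open>x \<star> (p \<star> p)\<close>.\<close>

lemma (in elliptic_group) comm_group_pointed_group:
  assumes p: "p \<in> carrier E"
  shows "comm_group (pointed_group E p)"
proof (rule comm_groupI)
  fix x y z
  assume xyz: "x \<in> carrier (pointed_group E p)" "y \<in> carrier (pointed_group E p)"
    "z \<in> carrier (pointed_group E p)"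
  \<comment> \<open>Applying \<open>p \<star> _\<close> to both sides gives the associative law; EG3
    swaps the outer entries \<open>z\<close> and \<open>x\<close> around the fixed
    \<open>p\<close>.\<close>
  then have "(p \<star> (x \<star> y)) \<star> z = x \<star> (p \<star> (y \<star> z))"
    using p EG1 [of "p \<star> (x \<star> y)" z] EG1 [of x y] EG3 [of z p y x] EG1[of z y]
    by (simp add: pointed_group_def closed)
  then show "x \<otimes>\<^bsub>pointed_group E p\<^esub> y \<otimes>\<^bsub>pointed_group E p\<^esub> z =
      x \<otimes>\<^bsub>pointed_group E p\<^esub> (y \<otimes>\<^bsub>pointed_group E p\<^esub> z)"
    by (simp add: pointed_group_def)
next
  fix x assume "x \<in> carrier (pointed_group E p)"
  then show "\<exists>y\<in>carrier (pointed_group E p). y \<otimes>\<^bsub>pointed_group E p\<^esub> x = \<one>\<^bsub>pointed_group E p\<^esub>"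
    using p by (intro bexI [of _ "x \<star> (p \<star> p)"])
      (simp_all add: pointed_group_def closed EG1 [of "x \<star> (p \<star> p)" x] EG2)
qed (use p in \<open>auto simp: pointed_group_def closed EG1 EG2 EG2'\<close>)

text \<open>By EG2 the group sum of \<open>x \<star> y\<close> and
  \<open>x + y = p \<star> (x \<star> y)\<close> is the constant \<open>p \<star> p\<close>; solving
  for \<open>x \<star> y\<close> gives the claim.\<close>

lemma (in elliptic_group) eop_pointed_group:
  assumes p: "p \<in> carrier E" and "x \<in> carrier E" "y \<in> carrier E"
  shows "x \<star>\<^bsub>elliptic_of (pointed_group E p) (p \<star> p)\<^esub> y = x \<star> y"
proof -
  let ?G = "pointed_group E p"
  interpret G: comm_group ?G by (rule comm_group_pointed_group [OF p])
  have c: "x \<in> carrier ?G" "y \<in> carrier ?G" "p \<star> p \<in> carrier ?G" "x \<star> y \<in> carrier ?G"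
    using assms by (simp_all add: pointed_group_def closed)
  have "(x \<star> y) \<otimes>\<^bsub>?G\<^esub> (x \<otimes>\<^bsub>?G\<^esub> y) = p \<star> p"
    using assms by (simp add: pointed_group_def closed EG2')
  then have "p \<star> p = ((x \<star> y) \<otimes>\<^bsub>?G\<^esub> y) \<otimes>\<^bsub>?G\<^esub> x"
    using c by (simp add: G.m_ac)
  then show ?thesis
    using c by (simp add: elliptic_of_def G.m_assoc)
qed

section \<open>Elliptic groups from abelian groups\<close>

lemma carrier_elliptic_of [simp]: "carrier (elliptic_of G a) = carrier G"
  by (simp add: elliptic_of_def)

lemma eop_elliptic_of: "x \<star>\<^bsub>elliptic_of G a\<^esub> y = a \<otimes>\<^bsub>G\<^esub> inv\<^bsub>G\<^esub> x \<otimes>\<^bsub>G\<^esub> inv\<^bsub>G\<^esub> y"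
  by (simp add: elliptic_of_def)

lemma (in comm_group) elliptic_group_elliptic_of:
  assumes a: "a \<in> carrier G"
  shows "elliptic_group (elliptic_of G a)"
proof
  fix x y z w
  assume "x \<in> carrier (elliptic_of G a)" "y \<in> carrier (elliptic_of G a)"
    "z \<in> carrier (elliptic_of G a)" "w \<in> carrier (elliptic_of G a)"
  then show "x \<star>\<^bsub>elliptic_of G a\<^esub> (y \<star>\<^bsub>elliptic_of G a\<^esub> (z \<star>\<^bsub>elliptic_of G a\<^esub> w)) =
      w \<star>\<^bsub>elliptic_of G a\<^esub> (y \<star>\<^bsub>elliptic_of G a\<^esub> (z \<star>\<^bsub>elliptic_of G a\<^esub> x))"
    using a by (simp add: eop_elliptic_of inv_mult m_ac)
next
  fix x y
  assume c: "x \<in> carrier (elliptic_of G a)" "y \<in> carrier (elliptic_of G a)"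
  show "x \<star>\<^bsub>elliptic_of G a\<^esub> (x \<star>\<^bsub>elliptic_of G a\<^esub> y) = y"
  proof -
    have "x \<star>\<^bsub>elliptic_of G a\<^esub> (x \<star>\<^bsub>elliptic_of G a\<^esub> y) = (a \<otimes> inv a) \<otimes> (x \<otimes> inv x) \<otimes> y"
      using a c by (simp only: eop_elliptic_of inv_mult m_ac carrier_elliptic_of inv_closed m_closed inv_inv)
    then show ?thesis using a c by simp
  qed
qed (use a in \<open>auto simp: eop_elliptic_of m_ac\<close>)

section \<open>Morphisms, and uniqueness of coproducts up to isomorphism\<close>

lemma elliptic_homD:
  assumes "f \<in> elliptic_hom S T"
  shows "x \<in> carrier S \<Longrightarrow> f x \<in> carrier T"
    and "x \<in> carrier S \<Longrightarrow> y \<in> carrier S \<Longrightarrow> f (x \<star>\<^bsub>S\<^esub> y) = f x \<star>\<^bsub>T\<^esub> f y"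
  using assms by (auto simp: elliptic_hom_def)

lemma elliptic_hom_compose:
  assumes "f \<in> elliptic_hom S T" "g \<in> elliptic_hom T U" "elliptic_group S"
  shows "compose (carrier S) g f \<in> elliptic_hom S U"
  using assms by (auto simp: elliptic_hom_def compose_def elliptic_group.closed Pi_iff)

lemma restrict_id_elliptic_hom:
  "elliptic_group S \<Longrightarrow> restrict (\<lambda>x. x) (carrier S) \<in> elliptic_hom S S"
  by (auto simp: elliptic_hom_def elliptic_group.closed)

lemma elliptic_coproduct_injections:
  assumes "elliptic_coproduct TYPE('e) S T C i j"
  shows "elliptic_group C" "i \<in> elliptic_hom S C" "j \<in> elliptic_hom T C"
  using assms by (auto simp: elliptic_coproduct_def)

lemma elliptic_coproduct_mediating:
  fixes E :: "'e elliptic"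
  assumes "elliptic_coproduct TYPE('e) S T C i j" "elliptic_group E"
    "f \<in> elliptic_hom S E" "g \<in> elliptic_hom T E"
  obtains h where "h \<in> elliptic_hom C E"
    "\<And>x. x \<in> carrier S \<Longrightarrow> h (i x) = f x" "\<And>y. y \<in> carrier T \<Longrightarrow> h (j y) = g y"
  using assms unfolding elliptic_coproduct_def by metis

text \<open>Both \<open>h\<close> and the identity mediate \<open>i\<close> and \<open>j\<close>
  themselves, so uniqueness identifies them. For this \<open>C\<close> must be a test object, whence
  the type \<open>'c\<close>; the identity is restricted to make it extensional.\<close>

lemma elliptic_coproduct_endo_eq:
  fixes C :: "'c elliptic"
  assumes C: "elliptic_coproduct TYPE('c) S T C i j"
    and h: "h \<in> elliptic_hom C C" "h \<in> extensional (carrier C)"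
    and "\<And>x. x \<in> carrier S \<Longrightarrow> h (i x) = i x" "\<And>y. y \<in> carrier T \<Longrightarrow> h (j y) = j y"
  shows "h = restrict (\<lambda>x. x) (carrier C)"
proof -
  note inj = elliptic_coproduct_injections [OF C]
  have "\<exists>!h. h \<in> elliptic_hom C C \<and> h \<in> extensional (carrier C) \<and>
      (\<forall>x \<in> carrier S. i x = h (i x)) \<and> (\<forall>y \<in> carrier T. j y = h (j y))"
    using C inj unfolding elliptic_coproduct_def by blast
  moreover have "\<forall>x \<in> carrier S. i x = restrict (\<lambda>x. x) (carrier C) (i x)"
    "\<forall>y \<in> carrier T. j y = restrict (\<lambda>x. x) (carrier C) (j y)"
    using elliptic_homD(1) [OF inj(2)] elliptic_homD(1) [OF inj(3)] by auto
  ultimately show ?thesis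
    using restrict_id_elliptic_hom [OF inj(1)] assms by (metis restrict_extensional)
qed

text \<open>The usual argument needs four instances because test objects live in a fixed type:
  \<open>CD\<close> and \<open>DC\<close> supply the maps between \<open>C\<close> and
  \<open>D\<close>, while \<open>CC\<close> and \<open>DD\<close> show that their composites are
  identities.\<close>

lemma elliptic_coproduct_unique:
  fixes C :: "'c elliptic" and D :: "'d elliptic"
  assumes CC: "elliptic_coproduct TYPE('c) S T C i j"
    and CD: "elliptic_coproduct TYPE('d) S T C i j"
    and DD: "elliptic_coproduct TYPE('d) S T D i' j'"
    and DC: "elliptic_coproduct TYPE('c) S T D i' j'"
  shows "elliptic_iso C D \<noteq> {}"
proof -
  note C = elliptic_coproduct_injections [OF CC]
  note D = elliptic_coproduct_injections [OF DD]
  note inC = elliptic_homD(1) [OF C(2)] elliptic_homD(1) [OF C(3)]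
  note inD = elliptic_homD(1) [OF D(2)] elliptic_homD(1) [OF D(3)]
  obtain h where h: "h \<in> elliptic_hom C D"
    "\<And>x. x \<in> carrier S \<Longrightarrow> h (i x) = i' x" "\<And>y. y \<in> carrier T \<Longrightarrow> h (j y) = j' y"
    using elliptic_coproduct_mediating [OF CD D] by blast
  obtain k where k: "k \<in> elliptic_hom D C"
    "\<And>x. x \<in> carrier S \<Longrightarrow> k (i' x) = i x" "\<And>y. y \<in> carrier T \<Longrightarrow> k (j' y) = j y"
    using elliptic_coproduct_mediating [OF DC C] by blast
  have kh: "compose (carrier C) k h = restrict (\<lambda>x. x) (carrier C)"
    by (rule elliptic_coproduct_endo_eq [OF CC elliptic_hom_compose [OF h(1) k(1) C(1)]])
      (use h k inC in \<open>auto simp: compose_def\<close>)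
  have hk: "compose (carrier D) h k = restrict (\<lambda>x. x) (carrier D)"
    by (rule elliptic_coproduct_endo_eq [OF DD elliptic_hom_compose [OF k(1) h(1) D(1)]])
      (use h k inD in \<open>auto simp: compose_def\<close>)
  have "bij_betw h (carrier C) (carrier D)"
  proof (rule bij_betwI [where g = k])
    show "h \<in> carrier C \<rightarrow> carrier D" "k \<in> carrier D \<rightarrow> carrier C"
      using h(1) k(1) by (auto simp: elliptic_hom_def)
    show "k (h x) = x" if "x \<in> carrier C" for x
      using fun_cong [OF kh, of x] that by (simp add: compose_def)
    show "h (k y) = y" if "y \<in> carrier D" for y
      using fun_cong [OF hk, of y] that by (simp add: compose_def)
  qed
  then show ?thesis
    using h(1) by (auto simp: elliptic_iso_def)
qed

section \<open>Elliptic morphisms versus group homomorphisms\<close>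

lemma hom_imp_elliptic_hom:
  assumes "group G" "group H" "f \<in> hom G H" "a \<in> carrier G"
  shows "f \<in> elliptic_hom (elliptic_of G a) (elliptic_of H (f a))"
proof -
  interpret group_hom G H f
    using assms by (simp add: group_hom_def group_hom_axioms_def)
  show ?thesis
    using assms(4) by (auto simp: elliptic_hom_def eop_elliptic_of)
qed

text \<open>Additively, \<open>0 - 0 - (0 - x - y) = x + y\<close>. Since the group law is thus an
  elliptic term in \<open>x\<close>, \<open>y\<close> and the neutral element, elliptic morphisms
  can be compared with homomorphisms.\<close>

lemma (in comm_group) mult_eq_eop:
  assumes "x \<in> carrier G" "y \<in> carrier G"
  shows "x \<otimes> y = \<one> \<star>\<^bsub>elliptic_of G \<one>\<^esub> (x \<star>\<^bsub>elliptic_of G \<one>\<^esub> y)"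
  using assms by (simp add: eop_elliptic_of inv_mult)

text \<open>An elliptic morphism may move the neutral element, so it is a homomorphism only up to
  translation. Applying \<open>f\<close> to the elliptic term for the product gives, additively,
  \<open>f (x + y) = - f 0 + f x + f y\<close>; the statement clears the inverse.\<close>

lemma elliptic_hom_mult:
  assumes "comm_group G" "comm_group H"
    and f: "f \<in> elliptic_hom (elliptic_of G \<one>\<^bsub>G\<^esub>) (elliptic_of H \<one>\<^bsub>H\<^esub>)"
    and x: "x \<in> carrier G" and y: "y \<in> carrier G"
  shows "f x \<otimes>\<^bsub>H\<^esub> f y = f (x \<otimes>\<^bsub>G\<^esub> y) \<otimes>\<^bsub>H\<^esub> f \<one>\<^bsub>G\<^esub>"
proof -
  interpret G: comm_group G by fact
  interpret H: comm_group H by fact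
  interpret elliptic_group "elliptic_of G \<one>\<^bsub>G\<^esub>"
    by (simp add: G.elliptic_group_elliptic_of)
  have [simp]: "f u \<in> carrier H" if "u \<in> carrier G" for u
    using elliptic_homD(1) [OF f] that by simp
  have cl: "x \<star>\<^bsub>elliptic_of G \<one>\<^bsub>G\<^esub>\<^esub> y \<in> carrier G"
    using closed x y by simp
  have "f (x \<otimes>\<^bsub>G\<^esub> y) =
      f \<one>\<^bsub>G\<^esub> \<star>\<^bsub>elliptic_of H \<one>\<^bsub>H\<^esub>\<^esub> (f x \<star>\<^bsub>elliptic_of H \<one>\<^bsub>H\<^esub>\<^esub> f y)"
    using cl x y elliptic_homD(2) [OF f] by (simp add: G.mult_eq_eop)
  also have "\<dots> = inv\<^bsub>H\<^esub> f \<one>\<^bsub>G\<^esub> \<otimes>\<^bsub>H\<^esub> (f x \<otimes>\<^bsub>H\<^esub> f y)"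
    using x y by (simp add: eop_elliptic_of H.inv_mult)
  finally show ?thesis
    using x y H.m_comm [of "f (x \<otimes>\<^bsub>G\<^esub> y)" "f \<one>\<^bsub>G\<^esub>"] by (simp add: H.inv_solve_left)
qed

lemma elliptic_hom_imp_hom:
  assumes "comm_group G" "comm_group H"
    and f: "f \<in> elliptic_hom (elliptic_of G \<one>\<^bsub>G\<^esub>) (elliptic_of H \<one>\<^bsub>H\<^esub>)"
    and "f \<one>\<^bsub>G\<^esub> = \<one>\<^bsub>H\<^esub>"
  shows "f \<in> hom G H"
proof (rule homI)
  interpret G: comm_group G by fact
  interpret H: comm_group H by fact
  show *: "f x \<in> carrier H" if "x \<in> carrier G" for x
    using elliptic_homD(1) [OF f] that by simp
  show "f (x \<otimes>\<^bsub>G\<^esub> y) = f x \<otimes>\<^bsub>H\<^esub> f y" if "x \<in> carrier G" "y \<in> carrier G" for x y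
    using elliptic_hom_mult [OF assms(1-3) that] * that assms(4) by simp
qed

text \<open>The neutral element satisfies \<open>0 = 0 \<star> 0\<close>, so its image
  \<open>e\<close> satisfies \<open>e = - 2 e\<close>. This relation is the source of the factor of
  order 3 in the coproduct.\<close>

lemma elliptic_hom_one_cube:
  assumes "comm_group G" "comm_group H"
    and f: "f \<in> elliptic_hom (elliptic_of G \<one>\<^bsub>G\<^esub>) (elliptic_of H \<one>\<^bsub>H\<^esub>)"
  shows "f \<one>\<^bsub>G\<^esub> [^]\<^bsub>H\<^esub> (3::int) = \<one>\<^bsub>H\<^esub>"
proof -
  interpret G: comm_group G by fact
  interpret H: comm_group H by fact
  let ?e = "f \<one>\<^bsub>G\<^esub>"
  have [simp]: "?e \<in> carrier H"
    using elliptic_homD(1) [OF f] by simp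
  have "?e = inv\<^bsub>H\<^esub> ?e \<otimes>\<^bsub>H\<^esub> inv\<^bsub>H\<^esub> ?e"
    using elliptic_homD(2) [OF f, of "\<one>\<^bsub>G\<^esub>" "\<one>\<^bsub>G\<^esub>"] by (simp add: eop_elliptic_of)
  also have "\<dots> = ?e [^]\<^bsub>H\<^esub> (-2::int)"
    using H.int_pow_mult [of ?e "-1" "-1"] by (simp add: H.int_pow_neg)
  finally have "?e [^]\<^bsub>H\<^esub> (1::int) \<otimes>\<^bsub>H\<^esub> ?e [^]\<^bsub>H\<^esub> (2::int) = \<one>\<^bsub>H\<^esub>"
    using H.int_pow_mult [of ?e "-2" 2] by simp
  then show ?thesis
    using H.int_pow_mult [of ?e 1 2] by simp
qed

section \<open>Powers modulo an exponent, direct products and the universal property\<close>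

lemma (in group) int_pow_mod:
  fixes m k :: int
  assumes x: "x \<in> carrier G" and "x [^] m = \<one>"
  shows "x [^] (k mod m) = x [^] k"
proof -
  have "x [^] k = x [^] (m * (k div m) + k mod m)" by simp
  also have "\<dots> = (x [^] m) [^] (k div m) \<otimes> x [^] (k mod m)"
    using x by (simp only: int_pow_mult int_pow_pow)
  finally show ?thesis using assms by simp
qed

lemma comm_group_DirProd:
  assumes "comm_group G" "comm_group H"
  shows "comm_group (G \<times>\<times> H)"
proof -
  interpret G: comm_group G by fact
  interpret H: comm_group H by fact
  interpret group "G \<times>\<times> H" by (simp add: DirProd_group)
  show ?thesis
    by (rule group_comm_groupI) (auto simp: G.m_comm H.m_comm)
qed

text \<open>The type \<open>'e\<close> of the test objects stays arbitrary, so that the universal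
  property can be instantiated at several types when coproducts are compared.\<close>

lemma elliptic_coproduct_DirProd:
  fixes A :: "'a monoid" and B :: "'b monoid"
  defines "P \<equiv> A \<times>\<times> (B \<times>\<times> integer_mod_group 3)"
    and "i \<equiv> (\<lambda>x. (x, \<one>\<^bsub>B\<^esub>, 0))"
    and "j \<equiv> (\<lambda>y. (\<one>\<^bsub>A\<^esub>, y, 1))"
  assumes A: "comm_group A" and B: "comm_group B"
  shows "elliptic_coproduct TYPE('e) (elliptic_of A \<one>\<^bsub>A\<^esub>) (elliptic_of B \<one>\<^bsub>B\<^esub>) (elliptic_of P \<one>\<^bsub>P\<^esub>) i j"
  unfolding elliptic_coproduct_def
proof (intro conjI allI impI)
  interpret A: comm_group A by (rule A)
  interpret B: comm_group B by (rule B)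
  interpret P: comm_group P
    unfolding P_def by (intro comm_group_DirProd A B abelian_integer_mod_group)
  have carrier_P: "carrier P = carrier A \<times> carrier B \<times> {0..<3}"
    by (simp add: P_def carrier_integer_mod_group)
  have mult_P: "(x, y, n) \<otimes>\<^bsub>P\<^esub> (x', y', n') = (x \<otimes>\<^bsub>A\<^esub> x', y \<otimes>\<^bsub>B\<^esub> y', (n + n') mod 3)"
    for x x' y y' n n'
    by (simp add: P_def)
  have one_P: "\<one>\<^bsub>P\<^esub> = (\<one>\<^bsub>A\<^esub>, \<one>\<^bsub>B\<^esub>, 0)"
    by (simp add: P_def)
  have inv_P: "inv\<^bsub>P\<^esub> (x, y, n) = (inv\<^bsub>A\<^esub> x, inv\<^bsub>B\<^esub> y, (- n) mod 3)"
    if "x \<in> carrier A" "y \<in> carrier B" "n \<in> {0..<3}" for x y n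
    using that by (intro P.inv_equality) (auto simp: mult_P one_P carrier_P mod_simps)
  show "elliptic_group (elliptic_of P \<one>\<^bsub>P\<^esub>)"
    by (simp add: P.elliptic_group_elliptic_of)
  show "i \<in> elliptic_hom (elliptic_of A \<one>\<^bsub>A\<^esub>) (elliptic_of P \<one>\<^bsub>P\<^esub>)"
    by (auto simp: elliptic_hom_def eop_elliptic_of i_def carrier_P inv_P mult_P one_P)
  \<comment> \<open>The constant third coordinate is preserved because \<open>- 1 - 1\<close> is
    congruent to \<open>1\<close> modulo 3.\<close>
  show "j \<in> elliptic_hom (elliptic_of B \<one>\<^bsub>B\<^esub>) (elliptic_of P \<one>\<^bsub>P\<^esub>)"
    by (auto simp: elliptic_hom_def eop_elliptic_of j_def carrier_P inv_P mult_P one_P)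

  fix E :: "'e elliptic" and f g
  assume E: "elliptic_group E"
    and f: "f \<in> elliptic_hom (elliptic_of A \<one>\<^bsub>A\<^esub>) E"
    and g: "g \<in> elliptic_hom (elliptic_of B \<one>\<^bsub>B\<^esub>) E"
  interpret E: elliptic_group E by (rule E)
  define p where "p = f \<one>\<^bsub>A\<^esub>"
  have p: "p \<in> carrier E"
    using elliptic_homD(1) [OF f] by (simp add: p_def)
  have pp: "p \<star>\<^bsub>E\<^esub> p = p"
    using elliptic_homD(2) [OF f, of "\<one>\<^bsub>A\<^esub>" "\<one>\<^bsub>A\<^esub>"] by (simp add: p_def eop_elliptic_of)
  define K where "K = pointed_group E p"
  interpret K: comm_group K
    unfolding K_def by (rule E.comm_group_pointed_group [OF p])
  have one_K: "\<one>\<^bsub>K\<^esub> = p" and carrier_K: "carrier K = carrier E"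
    by (simp_all add: K_def pointed_group_def)
  \<comment> \<open>As \<open>p\<close> is idempotent, the constant \<open>p \<star> p\<close> is
    the neutral element of \<open>K\<close>. The two operations are known to agree only on the
    carrier, so the sets of morphisms are equated rather than the structures.\<close>
  have hom_E: "elliptic_hom S E = elliptic_hom S (elliptic_of K \<one>\<^bsub>K\<^esub>)" for S :: "'s elliptic"
    using E.eop_pointed_group [OF p] pp
    by (auto simp: elliptic_hom_def carrier_K Pi_iff one_K simp flip: K_def)
  have f': "f \<in> hom A K"
    using f p_def by (intro elliptic_hom_imp_hom A K.comm_group_axioms) (simp_all add: hom_E one_K)
  let ?e = "g \<one>\<^bsub>B\<^esub>"
  note g' = g [unfolded hom_E]
  have f_closed [simp]: "f x \<in> carrier K" if "x \<in> carrier A" for x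
    using f' that by (auto simp: hom_def)
  have g_closed [simp]: "g y \<in> carrier K" if "y \<in> carrier B" for y
    using elliptic_homD(1) [OF g'] that by simp
  have cube: "?e [^]\<^bsub>K\<^esub> (3::int) = \<one>\<^bsub>K\<^esub>"
    by (rule elliptic_hom_one_cube [OF B K.comm_group_axioms g'])
  have g_mult: "g (y \<otimes>\<^bsub>B\<^esub> y') \<otimes>\<^bsub>K\<^esub> ?e = g y \<otimes>\<^bsub>K\<^esub> g y'"
    if "y \<in> carrier B" "y' \<in> carrier B" for y y'
    using elliptic_hom_mult [OF B K.comm_group_axioms g' that] by simp
  \<comment> \<open>The exponent is shifted because \<open>j\<close> already lands in class 1, where
    no correction is due. In class 0, the image of \<open>i\<close>, the factor
    \<open>?e [^] (-1)\<close> cancels the value \<open>?e\<close> of \<open>g\<close> at the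
    neutral element.\<close>
  define h where
    "h = restrict (\<lambda>(x, y, n). f x \<otimes>\<^bsub>K\<^esub> (g y \<otimes>\<^bsub>K\<^esub> ?e [^]\<^bsub>K\<^esub> (n - 1))) (carrier P)"
  have "h \<in> hom P K"
  proof (rule homI)
    show "h u \<in> carrier K" if "u \<in> carrier P" for u
      using that by (auto simp: h_def carrier_P)
    show "h (u \<otimes>\<^bsub>P\<^esub> v) = h u \<otimes>\<^bsub>K\<^esub> h v" if uv: "u \<in> carrier P" "v \<in> carrier P" for u v
    proof -
      obtain x y n x' y' n' where u: "u = (x, y, n)" and v: "v = (x', y', n')"
        by (metis prod.exhaust)
      have c: "x \<in> carrier A" "y \<in> carrier B" "x' \<in> carrier A" "y' \<in> carrier B"
        using uv by (simp_all add: u v carrier_P)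
      \<comment> \<open>Reduction modulo 3 is harmless since \<open>?e\<close> has trivial cube. The
        shift by 1 occurs once on the left but twice on the right, leaving one extra
        \<open>?e\<close>, which \<open>g_mult\<close> absorbs as the translation defect of
        \<open>g\<close>.\<close>
      have "?e [^]\<^bsub>K\<^esub> ((n + n') mod 3 - 1) = ?e [^]\<^bsub>K\<^esub> (((n + n') mod 3 - 1) mod 3)"
        by (rule K.int_pow_mod [OF _ cube, symmetric]) simp
      also have "\<dots> = ?e [^]\<^bsub>K\<^esub> ((n + n' - 1) mod 3)"
        by (simp only: mod_simps)
      also have "\<dots> = ?e [^]\<^bsub>K\<^esub> (1 + ((n - 1) + (n' - 1)))"
        by (simp add: K.int_pow_mod [OF _ cube] algebra_simps)
      also have "\<dots> = ?e \<otimes>\<^bsub>K\<^esub> (?e [^]\<^bsub>K\<^esub> (n - 1) \<otimes>\<^bsub>K\<^esub> ?e [^]\<^bsub>K\<^esub> (n' - 1))"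
        by (simp only: K.int_pow_mult g_closed B.one_closed K.int_pow_1)
      finally have e: "?e [^]\<^bsub>K\<^esub> ((n + n') mod 3 - 1) = \<dots>" .
      have "h (u \<otimes>\<^bsub>P\<^esub> v) = (f x \<otimes>\<^bsub>K\<^esub> f x') \<otimes>\<^bsub>K\<^esub>
          ((g (y \<otimes>\<^bsub>B\<^esub> y') \<otimes>\<^bsub>K\<^esub> ?e) \<otimes>\<^bsub>K\<^esub> (?e [^]\<^bsub>K\<^esub> (n - 1) \<otimes>\<^bsub>K\<^esub> ?e [^]\<^bsub>K\<^esub> (n' - 1)))"
        using P.m_closed [OF uv] c
        by (simp add: u v mult_P h_def e hom_mult [OF f'] K.m_assoc)
      also have "\<dots> = h u \<otimes>\<^bsub>K\<^esub> h v"
        using uv c unfolding g_mult [OF c(2,4)] by (simp add: u v h_def K.m_ac)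
      finally show ?thesis .
    qed
  qed
  then have h_hom: "h \<in> elliptic_hom (elliptic_of P \<one>\<^bsub>P\<^esub>) E"
    using hom_imp_elliptic_hom [of P K h "\<one>\<^bsub>P\<^esub>"] hom_one [OF _ P.group_axioms K.group_axioms]
    by (simp add: hom_E)
  have h_ext: "h \<in> extensional (carrier P)"
    by (simp add: h_def)
  have h_i: "f x = h (i x)" if "x \<in> carrier A" for x
    using that K.int_pow_neg [of ?e 1] by (simp add: h_def i_def carrier_P)
  have h_j: "g y = h (j y)" if "y \<in> carrier B" for y
    using that hom_one [OF f' A.group_axioms] by (simp add: h_def j_def carrier_P)
  have h_unique: "k = h"
    if k: "k \<in> elliptic_hom (elliptic_of P \<one>\<^bsub>P\<^esub>) E" "k \<in> extensional (carrier P)"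
      and ki: "\<forall>x \<in> carrier A. f x = k (i x)" and kj: "\<forall>y \<in> carrier B. g y = k (j y)"
    for k
  proof (rule extensionalityI [OF k(2)])
    show "h \<in> extensional (carrier P)" by (rule h_ext)
    \<comment> \<open>The neutral element of \<open>P\<close> is the image under \<open>i\<close> of
      that of \<open>A\<close>, so a competitor \<open>k\<close> sends it to \<open>p\<close>. Hence
      \<open>k\<close> is a group homomorphism into \<open>K\<close>, determined by its values on
      generators.\<close>
    have "k \<one>\<^bsub>P\<^esub> = \<one>\<^bsub>K\<^esub>"
      using ki by (simp add: one_K p_def one_P i_def)
    then have k': "k \<in> hom P K"
      using k(1) by (intro elliptic_hom_imp_hom P.comm_group_axioms K.comm_group_axioms)
        (simp_all add: hom_E)
    fix u assume u: "u \<in> carrier P"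
    obtain x y n where xyn: "u = (x, y, n)"
      by (metis prod.exhaust)
    have c: "x \<in> carrier A" "y \<in> carrier B" "n \<in> {0..<3}"
      using u by (simp_all add: xyn carrier_P)
    have ij: "i x \<in> carrier P" "j y \<in> carrier P" "j \<one>\<^bsub>B\<^esub> \<in> carrier P"
      using c by (simp_all add: i_def j_def carrier_P)
    \<comment> \<open>The exponent is one of -1, 0 and 1; for \<open>n = 0\<close> the inverse has
      third coordinate 2, the representative of -1.\<close>
    have pow: "j \<one>\<^bsub>B\<^esub> [^]\<^bsub>P\<^esub> (n - 1) = (\<one>\<^bsub>A\<^esub>, \<one>\<^bsub>B\<^esub>, (n - 1) mod 3)"
    proof -
      have "n = 0 \<or> n = 1 \<or> n = 2" using c by auto
      then show ?thesis
        using ij by (auto simp: P.int_pow_neg j_def inv_P one_P)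
    qed
    have "u = i x \<otimes>\<^bsub>P\<^esub> (j y \<otimes>\<^bsub>P\<^esub> j \<one>\<^bsub>B\<^esub> [^]\<^bsub>P\<^esub> (n - 1))"
      unfolding pow using c by (simp add: xyn i_def j_def mult_P mod_simps)
    then have "k u = k (i x) \<otimes>\<^bsub>K\<^esub> (k (j y) \<otimes>\<^bsub>K\<^esub> k (j \<one>\<^bsub>B\<^esub>) [^]\<^bsub>K\<^esub> (n - 1))"
      using ij k' by (simp add: hom_mult [OF k'] hom_int_pow [OF k' _ P.group_axioms K.group_axioms])
    also have "\<dots> = h u"
      using c ki kj u by (simp add: h_def xyn)
    finally show "k u = h u" .
  qed
  show "\<exists>!h. h \<in> elliptic_hom (elliptic_of P \<one>\<^bsub>P\<^esub>) E \<and>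
      h \<in> extensional (carrier (elliptic_of P \<one>\<^bsub>P\<^esub>)) \<and>
      (\<forall>x \<in> carrier (elliptic_of A \<one>\<^bsub>A\<^esub>). f x = h (i x)) \<and>
      (\<forall>y \<in> carrier (elliptic_of B \<one>\<^bsub>B\<^esub>). g y = h (j y))"
    unfolding carrier_elliptic_of
  proof (rule ex1I [of _ h])
    show "h \<in> elliptic_hom (elliptic_of P \<one>\<^bsub>P\<^esub>) E \<and> h \<in> extensional (carrier P) \<and>
        (\<forall>x \<in> carrier A. f x = h (i x)) \<and> (\<forall>y \<in> carrier B. g y = h (j y))"
      using h_hom h_ext h_i h_j by blast
  qed (elim conjE, rule h_unique)
qed

text \<open>The second conjunct gives the isomorphism: any coproduct \<open>C\<close> is isomorphic
  to \<open>P\<close>. It is required to be universal for test objects in its own type and in that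
  of \<open>P\<close>, so that the comparison maps exist and compose to identities.\<close>

theorem proposition10p1:
  fixes A :: "'a monoid" and B :: "'b monoid"
    and P :: "('a \<times> 'b \<times> int) elliptic"
    and i :: "'a \<Rightarrow> 'a \<times> 'b \<times> int" and j :: "'b \<Rightarrow> 'a \<times> 'b \<times> int"
  assumes A: "comm_group A" and B: "comm_group B"
  defines "P \<equiv> elliptic_of (A \<times>\<times> (B \<times>\<times> integer_mod_group 3))
                 \<one>\<^bsub>A \<times>\<times> (B \<times>\<times> integer_mod_group 3)\<^esub>"
    and "i \<equiv> (\<lambda>x. (x, \<one>\<^bsub>B\<^esub>, 0))"
    and "j \<equiv> (\<lambda>y. (\<one>\<^bsub>A\<^esub>, y, 1))"
  shows "elliptic_coproduct TYPE('e) (elliptic_of A \<one>\<^bsub>A\<^esub>) (elliptic_of B \<one>\<^bsub>B\<^esub>) P i j \<and>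
    (\<forall>(C :: 'c elliptic) i' j'.
       elliptic_coproduct TYPE('c) (elliptic_of A \<one>\<^bsub>A\<^esub>) (elliptic_of B \<one>\<^bsub>B\<^esub>) C i' j' \<longrightarrow>
       elliptic_coproduct TYPE('a \<times> 'b \<times> int) (elliptic_of A \<one>\<^bsub>A\<^esub>) (elliptic_of B \<one>\<^bsub>B\<^esub>) C i' j' \<longrightarrow>
       elliptic_iso C P \<noteq> {})"
  unfolding P_def i_def j_def
  by (intro conjI allI impI elliptic_coproduct_DirProd [OF A B]
    elliptic_coproduct_unique [OF _ _ elliptic_coproduct_DirProd [OF A B]
      elliptic_coproduct_DirProd [OF A B]])

end
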